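(* For each integer $d\geq 1$, let $$\mathbf y^*:=\bigl(2^{1/(d+1)},2^{2/(d+1)},\ldots,2^{d/(d+1)}\bigr)\in\mathbb R^d.$$ Then $\mathbf y^*\in\mathcal U_d^{\mathrm{Rational}}$. That is, the single function $$t\longmapsto\bigl|\mathbb Z^d\cap t(P+\mathbf y^* )\bigr|,\qquad t\in\mathbb Q_{>0},$$ is a complete invariant of $P$ among the full-dimensional rational polytopes in $\mathbb R^d$: if $P,Q\in\mathcal P_d(\mathbb Q)$ give the same function on $\mathbb Q_{>0}$, then $P=Q$.
   Context: $\mathcal P_d(\mathbb Q)$ denotes the collection of all full-dimensional rational (convex) polytopes in $\mathbb R^d$, i.e. convex hulls of finitely many points of $\mathbb Q^d$ that have nonempty interior in $\mathbb R^d$. For a bounded polytope $K\subset\mathbb R^d$ and real $t>0$, $L_K(t):=|tK\cap\mathbb Z^d|$. Define $$\mathcal U_d^{\mathrm{Rational}}:=\{\mathbf y\in\mathbb R^d : \text{for all } P,Q\in\mathcal P_d(\mathbb Q),\ \big(L_{P+\mathbf y}(t)=L_{Q+\mathbf y}(t)\ \text{for all } t\in\mathbb Q_{>0}\big)\Rightarrow P=Q\}.$$ *)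

theory Defs
  imports "HOL-Analysis.Analysis"
begin

definition integer_lattice :: "(real ^ 'n) set" where
  "integer_lattice = {x. \<forall>i. x $ i \<in> \<int>}"

definition rational_points :: "(real ^ 'n) set" where
  "rational_points = {x. \<forall>i. x $ i \<in> \<rat>}"

definition full_dim_rational_polytopes :: "(real ^ 'n) set set" where
  "full_dim_rational_polytopes =
     {P. (\<exists>V. finite V \<and> V \<subseteq> rational_points \<and> P = convex hull V) \<and> interior P \<noteq> {}}"

(* Meaningful for bounded K only: card is 0 on infinite sets. *)
definition lattice_point_count :: "(real ^ 'n) set \<Rightarrow> real \<Rightarrow> nat" where
  "lattice_point_count K t = card ((\<lambda>x. t *\<^sub>R x) ` K \<inter> integer_lattice)"

definition translate :: "(real ^ 'n) set \<Rightarrow> real ^ 'n \<Rightarrow> (real ^ 'n) set" where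
  "translate P y = (\<lambda>x. x + y) ` P"

definition U_rational :: "(real ^ 'n) set" where
  "U_rational =
     {y. \<forall>P \<in> full_dim_rational_polytopes. \<forall>Q \<in> full_dim_rational_polytopes.
           (\<forall>t \<in> \<rat>. t > 0 \<longrightarrow>
              lattice_point_count (translate P y) t = lattice_point_count (translate Q y) t)
           \<longrightarrow> P = Q}"

(* The dimension d is CARD('n). As the finite index type 'n carries no canonical
   numbering, the numbering idx of the coordinates by 1, ..., d is a parameter; it is
   meant to be a bijection from 'n onto {1..d}. *)
definition y_star :: "('n \<Rightarrow> nat) \<Rightarrow> real ^ 'n" where
  "y_star idx = (\<chi> i. 2 powr (real (idx i) / (real CARD('n) + 1)))"

end

theory Submission
  imports Defs "HOL-Real_Asymp.Real_Asymp" "HOL-Computational_Algebra.Fundamental_Theorem_Algebra"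
begin

text \<open>
  With \<open>\<alpha> = 2 powr (1 / (d + 1))\<close>, the numbers \<open>1\<close> and \<open>y\<^sub>i = \<alpha> ^ i\<close> are linearly independent over the
  rationals, because the roots of \<open>X ^ (d + 1) - 2\<close> all have modulus \<open>\<alpha>\<close>, so the constant coefficient
  of a proper rational factor would make an irrational power of \<open>\<alpha>\<close> rational.

  The lattice point \<open>x\<close> lies on the facet \<open>a \<bullet> z = b\<close> of \<open>P\<close>, dilated and translated, at the time \<open>\<tau>\<close>
  with \<open>a \<bullet> x = \<tau> * (b + a \<bullet> y)\<close>. By independence, \<open>\<tau>\<close> determines the rational vector \<open>(a, b)\<close> up to a
  nonzero rational factor. So all lattice points crossing the boundary at time
  \<open>\<tau>\<close> cross one facet, in the same direction, given by the sign of \<open>b + a \<bullet> y\<close>. If a point of \<open>Q\<close>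
  violates a facet inequality of \<open>P\<close>, choose \<open>\<tau>\<close> at which a lattice point crosses that facet: the count
  for \<open>P\<close> jumps in one direction, whereas that for \<open>Q\<close> is constant or jumps in the other direction.
  Rational times just before and just after \<open>\<tau>\<close> tell the two counts apart.
\<close>

section \<open>Rational independence of 1 and the coordinates of \<open>y_star\<close>\<close>

lemma poly_of_rat_mult:
  fixes x :: "'a::field_char_0"
  shows "poly (map_poly of_rat (p * q)) x = poly (map_poly of_rat p) x * poly (map_poly of_rat q) x"
proof (induction p)
  case (pCons a p)
  have add: "poly (map_poly of_rat (p + q)) x = poly (map_poly of_rat p) x + poly (map_poly of_rat q) x"
    for p q :: "rat poly"
    by (metis (no_types, lifting) coeff_add coeff_map_poly of_rat_0 of_rat_add poly_add poly_eqI)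
  have smult: "poly (map_poly of_rat (smult c p)) x = of_rat c * poly (map_poly of_rat p) x"
    for p :: "rat poly" and c
    by (metis (no_types, lifting) coeff_map_poly coeff_smult of_rat_0 of_rat_mult poly_eqI poly_smult)
  show ?case
    using pCons by (simp add: add smult map_poly_pCons algebra_simps)
qed auto

text \<open>With \<open>q = a / b\<close> and denominators cleared, the exponents of 2 on both sides
  satisfy n v(a) = m + n v(b).\<close>

lemma of_rat_power_eq_two_power_imp_dvd:
  assumes "(q::rat) ^ n = 2 ^ m"
  shows "n dvd m"
proof -
  obtain a b where q: "q = of_int a / of_int b" "b \<noteq> 0"
    by (metis quotient_of_div quotient_of_denom_pos less_irrefl surj_pair)
  have "of_int (a ^ n) = (of_int (2 ^ m * b ^ n) :: rat)"
    using assms q by (simp add: field_simps)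
  then have eq: "a ^ n = 2 ^ m * b ^ n" by (simp only: of_int_eq_iff)
  then have "a ^ n \<noteq> 0" using q by simp
  then have "multiplicity 2 (a ^ n) = n * multiplicity 2 a"
    by (cases "n = 0") (auto simp: prime_elem_multiplicity_power_distrib power_0_left)
  moreover have "multiplicity 2 (2 ^ m * b ^ n) = m + n * multiplicity 2 b"
    using q by (simp add: prime_elem_multiplicity_mult_distrib prime_elem_multiplicity_power_distrib)
  ultimately show ?thesis
    using eq by (metis dvd_add_left_iff dvd_triv_left)
qed

text \<open>A nonzero rational polynomial \<open>g\<close> of least degree vanishing at \<alpha>
  plays the role of the minimal polynomial. It divides X^n - 2, so the product of its complex roots
  has modulus \<alpha>^(degree g), which is also a quotient of coefficients of
  \<open>g\<close>.\<close>

lemma root_of_two_degree: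
  fixes p :: "rat poly" and \<alpha> :: real
  assumes "degree p < n" and "\<alpha> > 0" "\<alpha> ^ n = 2" and "poly (map_poly of_rat p) \<alpha> = 0"
  shows "p = 0"
proof (rule ccontr)
  assume "p \<noteq> 0"
  define R where "R = (\<lambda>g::rat poly. g \<noteq> 0 \<and> poly (map_poly of_rat g) \<alpha> = 0)"
  define g where "g = (ARG_MIN degree g. R g)"
  have "R p" using assms \<open>p \<noteq> 0\<close> by (simp add: R_def)
  then have g: "R g" and gmin: "\<And>h. R h \<Longrightarrow> degree g \<le> degree h"
    unfolding g_def by (auto intro: arg_min_natI arg_min_nat_le)
  define f :: "rat poly" where "f = monom 1 n - [:2:]"
  \<comment> \<open>Needed over two fields: at the real \<alpha> for the divisibility, and at the
    complex roots of \<open>g\<close> for their moduli.\<close>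
  have f: "poly (map_poly of_rat f) x = x ^ n - 2" for x :: "'a::field_char_0"
  proof -
    have "map_poly of_rat f = monom 1 n - [:2::'a:]"
      by (intro poly_eqI) (auto simp: f_def coeff_map_poly coeff_pCons of_rat_diff split: nat.splits)
    then show ?thesis by (simp add: poly_monom)
  qed
  have "g dvd f"
  proof (rule ccontr)
    assume "\<not> g dvd f"
    have "f mod g = f - g * (f div g)" by (simp add: minus_mult_div_eq_mod)
    then have "map_poly of_rat (f mod g) = map_poly of_rat f - (map_poly of_rat (g * (f div g)) :: real poly)"
      by (intro poly_eqI) (simp add: coeff_map_poly of_rat_diff)
    then have "R (f mod g)"
      using \<open>\<not> g dvd f\<close> g assms by (auto simp: R_def poly_of_rat_mult f mod_eq_0_iff_dvd)
    then show False
      using gmin g degree_mod_less[of g f] by (force simp: R_def mod_eq_0_iff_dvd)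
  qed
  define G :: "complex poly" where "G = map_poly of_rat g"
  have "G \<noteq> 0" and degG: "degree G = degree g"
    using g by (auto simp: G_def R_def map_poly_eq_0_iff degree_map_poly)
  then obtain A where A: "size A = degree G" "G = smult (lead_coeff G) (\<Prod>x\<in>#A. [:-x, 1:])"
    using alg_closed_imp_factorization by blast
  have rootA: "poly G z = 0" if "z \<in># A" for z
    using that by (subst A(2)) (auto simp: poly_prod_mset)
  have normA: "norm z = \<alpha>" if "z \<in># A" for z
  proof -
    obtain k where "f = g * k" using \<open>g dvd f\<close> by blast
    then have "z ^ n - 2 = 0"
      using rootA[OF that] by (simp add: G_def poly_of_rat_mult flip: f)
    then have "norm z ^ n = \<alpha> ^ n"
      using assms by (metis eq_iff_diff_eq_0 norm_power norm_numeral)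
    then show ?thesis
      using assms by (metis gr_implies_not0 less_eq_real_def norm_ge_zero not_gr_zero power_eq_imp_eq_base)
  qed
  have "norm (poly G 0) = norm (lead_coeff G) * norm (\<Prod>x\<in>#A. -x)"
    by (subst A(2)) (simp add: poly_prod_mset norm_mult)
  also have "norm (\<Prod>x\<in>#A. -x) = \<alpha> ^ size A"
    using normA by (induction A) (auto simp: norm_mult)
  finally have eq: "norm (of_rat (coeff g 0) :: complex) = norm (of_rat (lead_coeff g) :: complex) * \<alpha> ^ degree g"
    using A degG by (simp add: G_def poly_0_coeff_0 coeff_map_poly)
  have nr: "norm (of_rat r :: complex) = of_rat \<bar>r\<bar>" for r
  proof -
    have "(of_rat r :: complex) = of_real (of_rat r)"
      by (cases r) (simp add: of_rat_rat)
    then show ?thesis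
      by (auto simp: abs_if of_rat_minus)
  qed
  \<comment> \<open>The modulus of the product of the roots; \<open>g\<close> need not be monic,
    hence the division by the leading coefficient.\<close>
  define q where "q = \<bar>coeff g 0\<bar> / \<bar>lead_coeff g\<bar>"
  have "of_rat q = \<alpha> ^ degree g"
    using eq g by (simp add: nr q_def of_rat_divide R_def field_simps)
  then have "of_rat (q ^ n) = (of_rat (2 ^ degree g) :: real)"
    using assms by (simp add: of_rat_power flip: power_mult) (metis mult.commute power_mult)
  then have "n dvd degree g"
    using of_rat_power_eq_two_power_imp_dvd by (metis of_rat_eq_iff)
  moreover have "degree g < n" using gmin[OF \<open>R p\<close>] assms by linarith
  ultimately have "degree g = 0" by (auto dest: dvd_imp_le)
  then show False
    using g by (auto simp: R_def map_poly_pCons elim!: degree_eq_zeroE)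
qed

text \<open>A functional that is linear over the rationals preserves rational linear equations, so that
  applying it to the coefficients of a hyperplane through rational points makes them rational.\<close>
lemma rational_functional:
  assumes "(c::real) \<noteq> 0"
  obtains \<phi> :: "real \<Rightarrow> rat" where "\<And>x y. \<phi> (x + y) = \<phi> x + \<phi> y"
    "\<And>q x. \<phi> (of_rat q * x) = q * \<phi> x" "\<phi> c = 1"
proof -
  interpret vector_space_pair "\<lambda>(q::rat) (x::real). of_rat q * x" "(*) :: rat \<Rightarrow> rat \<Rightarrow> rat"
    by unfold_locales (auto simp: algebra_simps of_rat_add of_rat_mult)
  have ind: "vs1.independent {c}" using assms by simp
  \<comment> \<open>\<open>construct\<close> extends \<open>{c}\<close> to a basis of the reals over
    the rationals and prescribes the value 1 at \<open>c\<close>.\<close>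
  interpret l: Vector_Spaces.linear "\<lambda>(q::rat) (x::real). of_rat q * x" "(*) :: rat \<Rightarrow> rat \<Rightarrow> rat" "construct {c} (\<lambda>_. 1)"
    by (rule linear_construct[OF ind])
  show ?thesis
    using that[of "construct {c} (\<lambda>_. 1)"] l.add l.scale construct_basis[OF ind] by simp
qed

text \<open>A rational relation is a polynomial equation for \<alpha> of degree at most d =
  \<open>CARD('n)\<close>, below d + 1, with the values of \<open>idx\<close> as exponents. The
  polynomial therefore vanishes, and the coefficients can be read off because the exponents are
  distinct and positive.\<close>

lemma y_star_independent:
  fixes idx :: "'n::finite \<Rightarrow> nat" and r :: "real ^ 'n"
  assumes bij: "bij_betw idx UNIV {1..CARD('n)}"
    and r: "r \<in> rational_points" and s: "s \<in> \<rat>" and eq: "s + r \<bullet> y_star idx = 0"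
  shows "r = 0" "s = 0"
proof -
  define n where "n = CARD('n) + 1"
  define \<alpha> :: real where "\<alpha> = 2 powr (1 / n)"
  have \<alpha>: "\<alpha> > 0" "\<alpha> ^ n = 2"
  proof -
    show "\<alpha> > 0" by (simp add: \<alpha>_def)
    then have "\<alpha> ^ n = \<alpha> powr n" by (simp only: powr_realpow)
    then show "\<alpha> ^ n = 2" by (simp add: \<alpha>_def powr_powr n_def)
  qed
  have pow: "y_star idx $ i = \<alpha> ^ idx i" for i
    by (simp add: y_star_def \<alpha>_def n_def powr_powr add.commute flip: powr_realpow)
  obtain \<rho> where \<rho>: "r $ i = of_rat (\<rho> i)" for i
    using r unfolding rational_points_def Rats_def by (auto simp: image_iff) metis
  obtain \<sigma> where \<sigma>: "s = of_rat \<sigma>" using s by (auto elim: Rats_cases)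
  define p where "p = [:\<sigma>:] + (\<Sum>i\<in>UNIV. monom (\<rho> i) (idx i))"
  have range: "1 \<le> idx i" "idx i < n" for i
    using bij_betwE[OF bij] by (auto simp: n_def less_Suc_eq_le)
  have inj: "inj idx" using bij by (simp add: bij_betw_def)
  have coeff: "coeff p k = (if k = 0 then \<sigma> else 0) + (\<Sum>i\<in>UNIV. if idx i = k then \<rho> i else 0)" for k
    by (simp add: p_def coeff_sum coeff_pCons split: nat.splits)
  have deg: "degree p < n"
  proof -
    have "coeff p k = 0" if "n - 1 < k" for k
      using that range by (auto simp: coeff n_def intro!: sum.neutral) (metis not_less_eq)
    then show ?thesis
      using degree_le[of "n - 1" p] by (auto simp: n_def less_Suc_eq_le)
  qed
  have "poly (map_poly of_rat p) \<alpha> = s + (\<Sum>i\<in>UNIV. r $ i * \<alpha> ^ idx i)"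
  proof -
    have "map_poly of_rat p = [:s:] + (\<Sum>i\<in>UNIV. monom (r $ i) (idx i))"
      by (intro poly_eqI)
         (auto simp: coeff_map_poly coeff \<rho> \<sigma> coeff_sum coeff_pCons of_rat_add of_rat_sum
            intro!: sum.cong split: nat.splits)
    then show ?thesis by (simp add: poly_sum poly_monom)
  qed
  also have "\<dots> = 0" using eq by (simp add: inner_vec_def pow)
  finally have "p = 0" using root_of_two_degree[OF deg \<alpha>] by simp
  \<comment> \<open>No exponent is 0, so the constant coefficient is \<sigma> alone.\<close>
  have "(if idx i = 0 then \<rho> i else 0) = 0" for i using range(1)[of i] by simp
  then have "(\<Sum>i\<in>UNIV. if idx i = 0 then \<rho> i else 0) = 0" by (intro sum.neutral ballI)
  then have "\<sigma> = 0" using coeff[of 0] \<open>p = 0\<close> by simp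
  have "\<rho> i = 0" for i
  proof -
    have "(\<Sum>j\<in>UNIV. if idx j = idx i then \<rho> j else 0) = (\<Sum>j\<in>UNIV. if j = i then \<rho> j else 0)"
      using inj by (intro sum.cong) (auto dest: injD)
    then show ?thesis using coeff[of "idx i"] range(1)[of i] \<open>p = 0\<close> by simp
  qed
  then show "r = 0" "s = 0" using \<rho> \<sigma> \<open>\<sigma> = 0\<close> by (auto simp: vec_eq_iff)
qed

section \<open>Description of rational polytopes by irredundant rational halfspaces\<close>

lemma hyperplane_subset_hyperplane:
  fixes a a' :: "'a::real_inner"
  assumes "a \<noteq> 0" and sub: "{x. a \<bullet> x = b} \<subseteq> {x. a' \<bullet> x = b'}"
  obtains c where "a' = c *\<^sub>R a" "b' = c * b"
proof -
  \<comment> \<open>\<open>x0\<close> is the point of the first hyperplane nearest to the origin,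
    and \<open>v\<close> is the part of \<open>a'\<close> orthogonal to \<open>a\<close>. Moving
    from \<open>x0\<close> along \<open>v\<close> stays in both hyperplanes, which forces
    \<open>v\<close> to be orthogonal to itself.\<close>
  define x0 where "x0 = (b / (a \<bullet> a)) *\<^sub>R a"
  define c where "c = (a' \<bullet> a) / (a \<bullet> a)"
  define v where "v = a' - c *\<^sub>R a"
  have x0: "a \<bullet> x0 = b" using assms by (simp add: x0_def)
  have av: "a \<bullet> v = 0" using assms by (simp add: v_def c_def algebra_simps inner_commute)
  have a'x0: "a' \<bullet> x0 = b'" using sub x0 by auto
  have "a \<bullet> (x0 + v) = b" using x0 av by (simp add: inner_add_right)
  then have "a' \<bullet> (x0 + v) = b'" using sub by auto
  then have "a' \<bullet> v = 0" using a'x0 by (simp add: inner_add_right)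
  then have "v \<bullet> v = 0" using av by (simp add: v_def inner_diff_left)
  then have "a' = c *\<^sub>R a" by (simp add: v_def)
  moreover have "b' = c * b" using x0 a'x0 calculation by simp
  ultimately show ?thesis by (rule that)
qed

text \<open>Applying \<phi> to the coefficients gives a rational equation that still holds on
  \<open>V\<close>, hence on its affine hull, and so is a multiple of the given one. Positivity of
  \<open>c\<close> keeps the orientation of the halfspace.\<close>

lemma rational_hyperplane:
  fixes a :: "real ^ 'n"
  assumes "a \<noteq> 0" "V \<subseteq> rational_points" "affine hull V = {x. a \<bullet> x = b}"
  obtains c where "c > 0" "c *\<^sub>R a \<in> rational_points" "c * b \<in> \<rat>"
proof -
  \<comment> \<open>Normalizing \<phi> at a nonzero coordinate of \<open>a\<close> keeps the new
    normal vector from vanishing.\<close>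
  obtain j where "a $ j \<noteq> 0" using \<open>a \<noteq> 0\<close> by (auto simp: vec_eq_iff)
  then obtain \<phi> :: "real \<Rightarrow> rat" where add: "\<And>x y. \<phi> (x + y) = \<phi> x + \<phi> y"
    and scale: "\<And>q x. \<phi> (of_rat q * x) = q * \<phi> x" and "\<phi> (a $ j) = 1"
    using rational_functional by blast
  define a' :: "real ^ 'n" where "a' = (\<chi> i. of_rat (\<phi> (a $ i)))"
  have zero: "\<phi> 0 = 0" using scale[of 0 0] by simp
  have sum: "\<phi> (\<Sum>i\<in>I. f i) = (\<Sum>i\<in>I. \<phi> (f i))" for f :: "'n \<Rightarrow> real" and I
    by (induction I rule: infinite_finite_induct) (auto simp: zero add)
  have "a' \<bullet> v = of_rat (\<phi> b)" if "v \<in> V" for v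
  proof -
    have "\<forall>i. \<exists>x. v $ i = of_rat x"
      using assms(2) that unfolding rational_points_def Rats_def by auto
    then obtain \<rho> where \<rho>: "v $ i = of_rat (\<rho> i)" for i by metis
    have "a \<bullet> v = b" using assms(3) that hull_inc by fastforce
    then have "b = (\<Sum>i\<in>UNIV. of_rat (\<rho> i) * a $ i)"
      by (simp add: inner_vec_def \<rho> mult.commute)
    then have "\<phi> b = (\<Sum>i\<in>UNIV. \<rho> i * \<phi> (a $ i))" by (simp add: sum scale)
    then show ?thesis by (simp add: inner_vec_def a'_def \<rho> of_rat_sum of_rat_mult mult.commute)
  qed
  then have "affine hull V \<subseteq> {x. a' \<bullet> x = of_rat (\<phi> b)}"
    by (intro hull_minimal) (auto simp: affine_hyperplane)
  then obtain c where c: "a' = c *\<^sub>R a" "of_rat (\<phi> b) = c * b"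
    using hyperplane_subset_hyperplane[OF \<open>a \<noteq> 0\<close>] assms(3) by metis
  have a': "a' \<in> rational_points" "- a' \<in> rational_points" by (auto simp: a'_def rational_points_def)
  have cb: "c * b \<in> \<rat>" by (simp flip: c)
  have "a' $ j = 1" using \<open>\<phi> (a $ j) = 1\<close> by (simp add: a'_def)
  then have "c \<noteq> 0" using c by auto
  \<comment> \<open>If the factor found is negative, its negation serves, since \<open>- a'\<close>
    is rational too.\<close>
  then show ?thesis
    using that[of c] that[of "-c"] a' c cb by (cases "c > 0") auto
qed

text \<open>Each facet is the convex hull of some of the rational points in \<open>V\<close>, so its
  hyperplane can be rescaled to rational coefficients. Minimality of the family of halfspaces
  yields, for each inequality, a point violating only that one; such points later lead to the
  relative interior of a chosen facet.\<close>

lemma rational_polytope_halfspaces: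
  fixes P :: "(real ^ 'n) set"
  assumes P: "P \<in> full_dim_rational_polytopes"
  obtains H where "finite H" "P = {x. \<forall>(a, b)\<in>H. a \<bullet> x \<le> b}"
    "\<And>a b. (a, b) \<in> H \<Longrightarrow> a \<noteq> 0 \<and> a \<in> rational_points \<and> b \<in> \<rat>"
    "\<And>a b. (a, b) \<in> H \<Longrightarrow> \<exists>z. (\<forall>(a', b')\<in>H - {(a, b)}. a' \<bullet> z \<le> b') \<and> a \<bullet> z > b"
proof -
  obtain V where V: "finite V" "V \<subseteq> rational_points" "P = convex hull V" and int: "interior P \<noteq> {}"
    using P by (auto simp: full_dim_rational_polytopes_def)
  have "polyhedron P" using V by (simp add: polyhedron_convex_hull)
  have aff: "affine hull P = UNIV" using int by (rule affine_hull_nonempty_interior)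
  obtain F where F: "finite F" "P = affine hull P \<inter> \<Inter>F"
    and half: "\<forall>h\<in>F. \<exists>a b. a \<noteq> 0 \<and> h = {x. a \<bullet> x \<le> b}"
    and min: "\<And>F'. F' \<subset> F \<Longrightarrow> P \<subset> affine hull P \<inter> \<Inter>F'"
    using \<open>polyhedron P\<close> unfolding polyhedron_Int_affine_minimal by meson
  then obtain f g where fg: "\<And>h. h \<in> F \<Longrightarrow> f h \<noteq> 0 \<and> h = {x. f h \<bullet> x \<le> g h}"
    by metis
  have "\<exists>c>0. c *\<^sub>R f h \<in> rational_points \<and> c * g h \<in> \<rat>" if "h \<in> F" for h
  proof -
    let ?C = "P \<inter> {x. f h \<bullet> x = g h}"
    have facet: "?C facet_of P"
      using facet_of_polyhedron_explicit[OF F fg min] that by blast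
    then obtain V' where V': "V' \<subseteq> V" "?C = convex hull V'"
      using face_of_convex_hull_subset[of V] V by (metis facet_of_imp_face_of finite_imp_compact)
    have "affine hull V' = affine hull ?C" using V' by simp
    \<comment> \<open>As \<open>P\<close> is full-dimensional, its facet has the dimension of the
      hyperplane containing it, so it spans that hyperplane.\<close>
    also have "\<dots> = {x. f h \<bullet> x = g h}"
    proof (rule affine_dim_equal)
      show "affine hull ?C \<noteq> {}" using facet by (auto simp: facet_of_def)
      show "affine hull ?C \<subseteq> {x. f h \<bullet> x = g h}"
        by (intro hull_minimal) (auto simp: affine_hyperplane)
      have "aff_dim P = DIM(real ^ 'n)" using aff by (metis aff_dim_affine_hull aff_dim_UNIV)
      then show "aff_dim (affine hull ?C) = aff_dim {x. f h \<bullet> x = g h}"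
        using facet fg[OF that] by (simp add: facet_of_def)
    qed (auto simp: affine_hyperplane)
    finally show ?thesis
      using rational_hyperplane[of "f h" V' "g h"] fg[OF that] V V' by (metis subset_trans)
  qed
  then obtain c where c: "\<And>h. h \<in> F \<Longrightarrow> c h > 0 \<and> c h *\<^sub>R f h \<in> rational_points \<and> c h * g h \<in> \<rat>"
    by metis
  define k where "k = (\<lambda>h. (c h *\<^sub>R f h, c h * g h))"
  have mem: "x \<in> h \<longleftrightarrow> fst (k h) \<bullet> x \<le> snd (k h)" if "h \<in> F" for h x
  proof -
    have "x \<in> h \<longleftrightarrow> f h \<bullet> x \<le> g h" using fg[OF that] by blast
    then show ?thesis using c[OF that] by (simp add: k_def)
  qed
  show ?thesis
  proof (rule that[of "k ` F"])
    show "finite (k ` F)" using F by simp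
    have "P = \<Inter>F" using F(2) aff by simp
    then show "P = {x. \<forall>(a, b)\<in>k ` F. a \<bullet> x \<le> b}"
      using mem by (auto simp: case_prod_beta)
  next
    fix a b assume "(a, b) \<in> k ` F"
    then obtain h where h: "h \<in> F" "k h = (a, b)" by auto
    show "a \<noteq> 0 \<and> a \<in> rational_points \<and> b \<in> \<rat>"
      using h fg[of h] c[of h] by (auto simp: k_def)
    have "P \<subset> \<Inter>(F - {h})" using min[of "F - {h}"] h aff by auto
    then obtain z where z: "z \<in> \<Inter>(F - {h})" "z \<notin> P" by auto
    then have "z \<notin> h" using F(2) aff by auto
    then have "a \<bullet> z > b" using mem[OF h(1)] h by simp
    moreover have "\<forall>(a', b')\<in>k ` F - {(a, b)}. a' \<bullet> z \<le> b'"
      using z mem h by (auto simp: case_prod_beta)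
    ultimately show "\<exists>z. (\<forall>(a', b')\<in>k ` F - {(a, b)}. a' \<bullet> z \<le> b') \<and> a \<bullet> z > b" by blast
  qed
qed

section \<open>Lattice points in the dilates: variation with time, and points on facets\<close>

text \<open>For \<open>t > 0\<close> these are the lattice points of t(P + y), where P is cut out by
  \<open>H\<close>. In this form each bound is linear in \<open>t\<close>, and the sign of its slope
  \<open>b + a \<bullet> y\<close> tells which way the hyperplane moves.\<close>

definition dilate_lattice_points :: "((real ^ 'n) \<times> real) set \<Rightarrow> real ^ 'n \<Rightarrow> real \<Rightarrow> (real ^ 'n) set" where
  "dilate_lattice_points H y t = {x \<in> integer_lattice. \<forall>(a, b)\<in>H. a \<bullet> x \<le> t * (b + a \<bullet> y)}"

lemma dilate_translate_halfspaces:
  assumes "t > 0"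
  shows "(\<lambda>x. t *\<^sub>R x) ` translate {x. \<forall>(a, b)\<in>H. a \<bullet> x \<le> b} y =
    {x. \<forall>(a, b)\<in>H. a \<bullet> x \<le> t * (b + a \<bullet> y)}" (is "?L = ?R")
proof -
  have "x \<in> ?L \<longleftrightarrow> x /\<^sub>R t - y \<in> {x. \<forall>(a, b)\<in>H. a \<bullet> x \<le> b}" for x
  proof
    assume "x /\<^sub>R t - y \<in> {x. \<forall>(a, b)\<in>H. a \<bullet> x \<le> b}"
    then have "t *\<^sub>R ((x /\<^sub>R t - y) + y) \<in> ?L" unfolding translate_def by blast
    then show "x \<in> ?L" using assms by simp
  qed (use assms in \<open>auto simp: translate_def\<close>)
  also have "\<dots> x \<longleftrightarrow> x \<in> ?R" for x
    using assms by (simp add: inner_diff_right field_simps split_beta)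
  finally show ?thesis by blast
qed

lemma lattice_point_count_halfspaces:
  assumes "t > 0"
  shows "lattice_point_count (translate {x. \<forall>(a, b)\<in>H. a \<bullet> x \<le> b} y) t = card (dilate_lattice_points H y t)"
  unfolding lattice_point_count_def dilate_translate_halfspaces[OF assms] dilate_lattice_points_def
  by (rule arg_cong[where f = card]) blast

lemma finite_integer_lattice_Int_bounded:
  assumes "bounded S"
  shows "finite (S \<inter> integer_lattice)"
proof -
  obtain M where M: "\<And>x. x \<in> S \<Longrightarrow> norm x \<le> M" using assms by (auto simp: bounded_iff)
  have "vec_nth ` (S \<inter> integer_lattice) \<subseteq> (UNIV \<rightarrow>\<^sub>E {k \<in> \<int>. \<bar>k\<bar> \<le> M})"
    using M by (auto simp: integer_lattice_def intro: order_trans[OF component_le_norm_cart])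
  then have "finite (vec_nth ` (S \<inter> integer_lattice))"
    by (rule finite_subset) (intro finite_PiE finite_abs_int_segment finite)
  then show ?thesis
    by (rule finite_imageD) (auto simp: inj_on_def vec_nth_inject)
qed

text \<open>All dilates up to time \<open>T\<close> lie in one ball. Finiteness of the whole union
  lets the neighbourhoods found below for single points be intersected.\<close>

lemma finite_dilate_lattice_points:
  assumes "bounded {x. \<forall>(a, b)\<in>H. a \<bullet> x \<le> b}"
  shows "finite (\<Union>t\<in>{0<..T}. dilate_lattice_points H y t)"
proof -
  let ?P = "{x. \<forall>(a, b)\<in>H. a \<bullet> x \<le> b}"
  have "bounded (translate ?P y)" unfolding translate_def
    using assms by (metis (no_types, lifting) add.commute bounded_translation image_cong)
  then obtain M where M: "\<And>x. x \<in> translate ?P y \<Longrightarrow> norm x \<le> M" by (auto simp: bounded_iff)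
  have "(\<Union>t\<in>{0<..T}. dilate_lattice_points H y t) \<subseteq> cball 0 (T * M) \<inter> integer_lattice"
  proof clarify
    fix x t assume t: "t \<in> {0<..T}" and x: "x \<in> dilate_lattice_points H y t"
    then have "x \<in> (\<lambda>x. t *\<^sub>R x) ` translate ?P y"
      by (subst dilate_translate_halfspaces) (auto simp: dilate_lattice_points_def)
    then obtain z where "z \<in> translate ?P y" "x = t *\<^sub>R z" by blast
    then show "x \<in> cball 0 (T * M) \<inter> integer_lattice"
      using t x M[of z] by (auto simp: dilate_lattice_points_def intro!: mult_mono)
  qed
  then show ?thesis
    using finite_integer_lattice_Int_bounded[OF bounded_cball] finite_subset by blast
qed

lemma finite_dilate_lattice_points_at:
  assumes "bounded {x. \<forall>(a, b)\<in>H. a \<bullet> x \<le> b}" "t > 0"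
  shows "finite (dilate_lattice_points H y t)"
proof -
  have "dilate_lattice_points H y t \<subseteq> (\<Union>s\<in>{0<..t}. dilate_lattice_points H y s)"
    using \<open>t > 0\<close> by (intro UN_upper) simp
  then show ?thesis
    using finite_dilate_lattice_points[OF assms(1)] by (rule finite_subset)
qed

text \<open>A point outside the closed dilate at \<tau> violates some inequality strictly, and still
  does so at nearby times. Only the finitely many points present before \<tau> + 1 matter.\<close>

lemma eventually_dilate_lattice_points_subset:
  assumes bdd: "bounded {x. \<forall>(a, b)\<in>H. a \<bullet> x \<le> b}" and "\<tau> > 0"
  shows "\<forall>\<^sub>F t in nhds \<tau>. dilate_lattice_points H y t \<subseteq> dilate_lattice_points H y \<tau>"
proof -
  define X where "X = (\<Union>t\<in>{0<..\<tau> + 1}. dilate_lattice_points H y t)"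
  have "finite X" unfolding X_def using bdd by (rule finite_dilate_lattice_points)
  have "\<forall>\<^sub>F t in nhds \<tau>. x \<notin> dilate_lattice_points H y t" if "x \<in> X - dilate_lattice_points H y \<tau>" for x
  proof -
    have "\<exists>(a, b)\<in>H. a \<bullet> x > \<tau> * (b + a \<bullet> y)"
      using that unfolding X_def dilate_lattice_points_def by (fastforce simp: not_le)
    then obtain a b where ab: "(a, b) \<in> H" "a \<bullet> x > \<tau> * (b + a \<bullet> y)" by blast
    have "((\<lambda>t. t * (b + a \<bullet> y)) \<longlongrightarrow> \<tau> * (b + a \<bullet> y)) (nhds \<tau>)"
      by (intro tendsto_intros filterlim_ident)
    then have "\<forall>\<^sub>F t in nhds \<tau>. t * (b + a \<bullet> y) < a \<bullet> x" using ab(2) by (rule order_tendstoD)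
    then show ?thesis
      by eventually_elim (use ab in \<open>force simp: dilate_lattice_points_def\<close>)
  qed
  then have "\<forall>\<^sub>F t in nhds \<tau>. \<forall>x\<in>X - dilate_lattice_points H y \<tau>. x \<notin> dilate_lattice_points H y t"
    using \<open>finite X\<close> by (intro eventually_ball_finite) auto
  moreover have "\<forall>\<^sub>F t in nhds \<tau>. t \<in> {0<..<\<tau> + 1}"
    using \<open>\<tau> > 0\<close> by (intro eventually_nhds_in_open) auto
  ultimately show ?thesis
    by eventually_elim (force simp: X_def)
qed

text \<open>Slack inequalities survive small changes of time, so only tight ones can expel a point.
  The sign of \<sigma> selects the side of \<tau> on which all tight hyperplanes have moved
  outward.\<close>

lemma eventually_dilate_lattice_points_superset:
  assumes "finite H" and bdd: "bounded {x. \<forall>(a, b)\<in>H. a \<bullet> x \<le> b}" and "\<tau> > 0"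
    and tight: "\<And>x a b. x \<in> dilate_lattice_points H y \<tau> \<Longrightarrow> (a, b) \<in> H \<Longrightarrow>
      a \<bullet> x = \<tau> * (b + a \<bullet> y) \<Longrightarrow> \<sigma> * (b + a \<bullet> y) > 0"
  shows "\<forall>\<^sub>F t in nhds \<tau>. \<sigma> * (t - \<tau>) > 0 \<longrightarrow> dilate_lattice_points H y \<tau> \<subseteq> dilate_lattice_points H y t"
proof -
  have "\<forall>\<^sub>F t in nhds \<tau>. \<sigma> * (t - \<tau>) > 0 \<longrightarrow> a \<bullet> x \<le> t * (b + a \<bullet> y)"
    if x: "x \<in> dilate_lattice_points H y \<tau>" and ab: "(a, b) \<in> H" for x a b
  proof (cases "a \<bullet> x = \<tau> * (b + a \<bullet> y)")
    case True
    have "a \<bullet> x \<le> t * (b + a \<bullet> y)" if "\<sigma> * (t - \<tau>) > 0" for t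
    proof -
      have "(t - \<tau>) * (b + a \<bullet> y) > 0"
        using that tight[OF x ab True] by (auto simp: zero_less_mult_iff)
      then show ?thesis using True by (simp add: algebra_simps)
    qed
    then show ?thesis by simp
  next
    case False
    then have "\<tau> * (b + a \<bullet> y) > a \<bullet> x" using x ab by (fastforce simp: dilate_lattice_points_def)
    moreover have "((\<lambda>t. t * (b + a \<bullet> y)) \<longlongrightarrow> \<tau> * (b + a \<bullet> y)) (nhds \<tau>)"
      by (intro tendsto_intros filterlim_ident)
    ultimately have "\<forall>\<^sub>F t in nhds \<tau>. t * (b + a \<bullet> y) > a \<bullet> x" by (simp add: order_tendstoD)
    then show ?thesis by eventually_elim simp
  qed
  moreover have "finite (dilate_lattice_points H y \<tau>)"
    using bdd \<open>\<tau> > 0\<close> by (rule finite_dilate_lattice_points_at)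
  ultimately have "\<forall>\<^sub>F t in nhds \<tau>. \<forall>x\<in>dilate_lattice_points H y \<tau>. \<forall>h\<in>H. \<sigma> * (t - \<tau>) > 0 \<longrightarrow> fst h \<bullet> x \<le> t * (snd h + fst h \<bullet> y)"
    using \<open>finite H\<close> by (intro eventually_ball_finite ballI) auto
  then show ?thesis
    by eventually_elim (fastforce simp: dilate_lattice_points_def)
qed

text \<open>The segment from the interior point \<open>p0\<close> to \<open>z\<close> meets the
  hyperplane of \<open>(a, b)\<close> at a point \<open>p\<close> where all other inequalities are
  strict. This leaves room to replace \<open>p + y\<close> by a nearby rational point, which is then
  scaled up to a lattice point.\<close>

lemma ex_lattice_point_on_facet:
  fixes y :: "real ^ 'n"
  assumes "finite H" and h: "(a, b) \<in> H" and beta: "b + a \<bullet> y \<noteq> 0"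
    and p0: "\<forall>(a', b')\<in>H. a' \<bullet> p0 < b'"
    and z: "\<forall>(a', b')\<in>H - {(a, b)}. a' \<bullet> z \<le> b'" "a \<bullet> z > b"
  obtains \<tau> x where "\<tau> > 0" "x \<in> dilate_lattice_points H y \<tau>" "a \<bullet> x = \<tau> * (b + a \<bullet> y)"
proof -
  define \<beta> where "\<beta> = b + a \<bullet> y"
  define u where "u = (b - a \<bullet> p0) / (a \<bullet> z - a \<bullet> p0)"
  define p where "p = (1 - u) *\<^sub>R p0 + u *\<^sub>R z"
  have ap0: "a \<bullet> p0 < b" using p0 h by auto
  then have u: "0 < u" "u < 1" using z by (auto simp: u_def field_simps)
  have "a \<bullet> p = a \<bullet> p0 + u * (a \<bullet> z - a \<bullet> p0)" by (simp add: p_def inner_add_right algebra_simps)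
  then have ap: "a \<bullet> p = b" using ap0 z by (simp add: u_def)
  have strict: "a' \<bullet> p < b'" if "(a', b') \<in> H - {(a, b)}" for a' b'
  proof -
    have "(1 - u) * (a' \<bullet> p0) + u * (a' \<bullet> z) < (1 - u) * b' + u * b'"
      using that p0 z u by (intro add_less_le_mono mult_strict_left_mono mult_left_mono) auto
    then show ?thesis by (simp add: p_def inner_add_right algebra_simps)
  qed
  \<comment> \<open>Perturb \<open>p\<close> inside its facet so that \<open>p + y\<close> gets a rational direction \<open>r n\<close>.\<close>
  define r where "r = (\<lambda>n::nat. (\<chi> i. of_int \<lfloor>real n * (p + y) $ i\<rfloor> / real n) :: real ^ 'n)"
  have r: "r \<longlonglongrightarrow> p + y"
  proof (rule vec_tendstoI)
    fix i
    show "(\<lambda>n. r n $ i) \<longlonglongrightarrow> (p + y) $ i"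
      unfolding r_def vec_lambda_beta by real_asymp
  qed
  \<comment> \<open>This quotient is the time at which the moving hyperplane contains
    \<open>r n\<close>. The limit is 1 because \<open>p + y\<close> lies on the hyperplane at time
    1.\<close>
  have ar: "(\<lambda>n. a \<bullet> r n / \<beta>) \<longlonglongrightarrow> 1"
  proof -
    have "(\<lambda>n. a \<bullet> r n / \<beta>) \<longlonglongrightarrow> a \<bullet> (p + y) / \<beta>"
      using beta by (intro tendsto_intros r) (auto simp: \<beta>_def)
    then show ?thesis using ap beta by (simp add: \<beta>_def inner_add_right)
  qed
  have "\<forall>\<^sub>F n in sequentially. a' \<bullet> r n \<le> (a \<bullet> r n / \<beta>) * (b' + a' \<bullet> y)" if "(a', b') \<in> H" for a' b'
  proof (cases "(a', b') = (a, b)")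
    case True
    then show ?thesis using beta by (simp add: \<beta>_def)
  next
    case False
    have "(\<lambda>n. (a \<bullet> r n / \<beta>) * (b' + a' \<bullet> y) - a' \<bullet> r n) \<longlonglongrightarrow> 1 * (b' + a' \<bullet> y) - a' \<bullet> (p + y)"
      by (intro tendsto_intros ar r)
    moreover have "1 * (b' + a' \<bullet> y) - a' \<bullet> (p + y) > 0"
      using strict[of a' b'] that False by (simp add: inner_add_right)
    ultimately have "\<forall>\<^sub>F n in sequentially. (a \<bullet> r n / \<beta>) * (b' + a' \<bullet> y) - a' \<bullet> r n > 0"
      by (rule order_tendstoD)
    then show ?thesis by eventually_elim simp
  qed
  then have "\<forall>\<^sub>F n in sequentially. \<forall>h\<in>H. fst h \<bullet> r n \<le> (a \<bullet> r n / \<beta>) * (snd h + fst h \<bullet> y)"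
    using \<open>finite H\<close> by (intro eventually_ball_finite) auto
  moreover have "\<forall>\<^sub>F n in sequentially. a \<bullet> r n / \<beta> > 0"
    using ar by (rule order_tendstoD) simp
  ultimately have ev: "\<forall>\<^sub>F n in sequentially. (\<forall>h\<in>H. fst h \<bullet> r n \<le> (a \<bullet> r n / \<beta>) * (snd h + fst h \<bullet> y)) \<and>
      a \<bullet> r n / \<beta> > 0 \<and> n > 0"
    using eventually_gt_at_top[of 0] by eventually_elim auto
  then obtain n where n': "\<forall>h\<in>H. fst h \<bullet> r n \<le> (a \<bullet> r n / \<beta>) * (snd h + fst h \<bullet> y)"
    and n: "a \<bullet> r n / \<beta> > 0" "n > 0"
    using eventually_happens'[OF sequentially_bot ev] by blast
  show ?thesis
  \<comment> \<open>The inequalities are homogeneous in point and time, so both may be multiplied by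
    \<open>n\<close>, which clears the denominators of \<open>r n\<close>.\<close>
  proof (rule that[of "real n * (a \<bullet> r n / \<beta>)" "real n *\<^sub>R r n"])
    show "real n * (a \<bullet> r n / \<beta>) > 0" using n by (intro mult_pos_pos) auto
    show "real n *\<^sub>R r n \<in> dilate_lattice_points H y (real n * (a \<bullet> r n / \<beta>))"
    proof -
      have "real n *\<^sub>R r n \<in> integer_lattice" using n by (simp add: integer_lattice_def r_def)
      moreover have "a' \<bullet> (real n *\<^sub>R r n) \<le> real n * (a \<bullet> r n / \<beta>) * (b' + a' \<bullet> y)"
        if "(a', b') \<in> H" for a' b'
        using mult_left_mono[OF bspec[OF n' that], of "real n"] by (simp add: mult.assoc)
      ultimately show ?thesis by (auto simp: dilate_lattice_points_def)
    qed
    show "a \<bullet> (real n *\<^sub>R r n) = real n * (a \<bullet> r n / \<beta>) * (b + a \<bullet> y)"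
      using beta by (simp add: \<beta>_def)
  qed
qed

section \<open>Crossing times and the comparison of two polytopes\<close>

lemma integer_inner_rational:
  assumes "a \<in> rational_points" "x \<in> integer_lattice"
  shows "a \<bullet> x \<in> \<rat>"
proof -
  have "a $ i * x $ i \<in> \<rat>" for i
    using assms Ints_subset_Rats by (auto simp: rational_points_def integer_lattice_def intro!: Rats_mult)
  then show ?thesis
    by (simp add: inner_vec_def Rats_sum)
qed

text \<open>Eliminating \<tau> from the two equations leaves a rational relation between 1 and the
  coordinates of \<open>y\<close>, whose coefficients must vanish. The two inequalities may come
  from different polytopes and be tight at different lattice points.\<close>

lemma tight_proportional:
  fixes y :: "real ^ 'n"
  assumes indep: "\<And>r s. r \<in> rational_points \<Longrightarrow> s \<in> \<rat> \<Longrightarrow> s + r \<bullet> y = 0 \<Longrightarrow> r = 0 \<and> s = 0"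
    and a: "a \<in> rational_points" "b \<in> \<rat>" "a \<noteq> 0" and a': "a' \<in> rational_points" "b' \<in> \<rat>" "a' \<noteq> 0"
    and x: "x \<in> integer_lattice" "a \<bullet> x = \<tau> * (b + a \<bullet> y)"
    and x': "x' \<in> integer_lattice" "a' \<bullet> x' = \<tau> * (b' + a' \<bullet> y)"
    and "\<tau> > 0"
  obtains c where "c \<noteq> 0" "a' = c *\<^sub>R a" "b' = c * b"
proof -
  define k where "k = a \<bullet> x"
  define k' where "k' = a' \<bullet> x'"
  \<comment> \<open>Independence and \<open>a \<noteq> 0\<close> make
    \<open>b + a \<bullet> y\<close> nonzero, and \<tau> is positive.\<close>
  have "k \<noteq> 0" using indep[of a b] a x \<open>\<tau> > 0\<close> by (auto simp: k_def)
  have rat: "k \<in> \<rat>" "k' \<in> \<rat>" using integer_inner_rational a a' x(1) x'(1) by (auto simp only: k_def k'_def)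
  have "k *\<^sub>R a' - k' *\<^sub>R a \<in> rational_points"
    using rat a a' by (simp add: rational_points_def)
  moreover have "k * b' - k' * b \<in> \<rat>" using rat a a' by simp
  moreover have "(k * b' - k' * b) + (k *\<^sub>R a' - k' *\<^sub>R a) \<bullet> y = 0"
    using x x' by (simp add: k_def k'_def inner_diff_left) (simp add: algebra_simps)
  ultimately have "k *\<^sub>R a' - k' *\<^sub>R a = 0" "k * b' - k' * b = 0" using indep by blast+
  then have eq: "k *\<^sub>R a' = k' *\<^sub>R a" "k * b' = k' * b" by auto
  have "a' = (k' / k) *\<^sub>R a"
    using arg_cong[OF eq(1), of "\<lambda>v. inverse k *\<^sub>R v"] \<open>k \<noteq> 0\<close> by (simp add: field_simps)
  moreover have "b' = (k' / k) * b" using eq \<open>k \<noteq> 0\<close> by (simp add: field_simps)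
  moreover have "k' / k \<noteq> 0" using calculation a' by auto
  ultimately show ?thesis using that by blast
qed

lemma equal_counts_imp_subset:
  fixes y :: "real ^ 'n"
  assumes indep: "\<And>r s. r \<in> rational_points \<Longrightarrow> s \<in> \<rat> \<Longrightarrow> s + r \<bullet> y = 0 \<Longrightarrow> r = 0 \<and> s = 0"
    and P: "P \<in> full_dim_rational_polytopes" and Q: "Q \<in> full_dim_rational_polytopes"
    and counts: "\<And>t. t \<in> \<rat> \<Longrightarrow> t > 0 \<Longrightarrow>
      lattice_point_count (translate P y) t = lattice_point_count (translate Q y) t"
  shows "Q \<subseteq> P"
proof (rule ccontr)
  assume "\<not> Q \<subseteq> P"
  obtain H where H: "finite H" and PH: "P = {x. \<forall>(a, b)\<in>H. a \<bullet> x \<le> b}"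
    and Hrat: "\<And>a b. (a, b) \<in> H \<Longrightarrow> a \<noteq> 0 \<and> a \<in> rational_points \<and> b \<in> \<rat>"
    and Hmin: "\<And>a b. (a, b) \<in> H \<Longrightarrow> \<exists>z. (\<forall>(a', b')\<in>H - {(a, b)}. a' \<bullet> z \<le> b') \<and> a \<bullet> z > b"
    using rational_polytope_halfspaces[OF P] by blast
  obtain K where K: "finite K" and QK: "Q = {x. \<forall>(a, b)\<in>K. a \<bullet> x \<le> b}"
    and Krat: "\<And>a b. (a, b) \<in> K \<Longrightarrow> a \<noteq> 0 \<and> a \<in> rational_points \<and> b \<in> \<rat>"
    using rational_polytope_halfspaces[OF Q] by blast
  have "bounded P" "bounded Q" and "interior P \<noteq> {}"
    using P Q by (auto simp: full_dim_rational_polytopes_def intro: finite_imp_bounded bounded_convex_hull)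
  obtain q a b where q: "q \<in> Q" and h: "(a, b) \<in> H" and aq: "a \<bullet> q > b"
    using \<open>\<not> Q \<subseteq> P\<close> by (force simp: PH)
  obtain p0 where "p0 \<in> interior P" using \<open>interior P \<noteq> {}\<close> by auto
  have p0: "a' \<bullet> p0 < b'" if "(a', b') \<in> H" for a' b'
  proof -
    have "P \<subseteq> {x. a' \<bullet> x \<le> b'}" using that by (auto simp: PH)
    then have "p0 \<in> interior {x. a' \<bullet> x \<le> b'}" using \<open>p0 \<in> interior P\<close> interior_mono by blast
    then show ?thesis using Hrat[OF that] by simp
  qed
  define \<beta> where "\<beta> = b + a \<bullet> y"
  have "\<beta> \<noteq> 0" using indep[of a b] Hrat[OF h] by (auto simp: \<beta>_def)
  obtain z where "\<forall>(a', b')\<in>H - {(a, b)}. a' \<bullet> z \<le> b'" "a \<bullet> z > b" using Hmin[OF h] by blast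
  then obtain \<tau> x where \<tau>: "\<tau> > 0" and x: "x \<in> dilate_lattice_points H y \<tau>" "a \<bullet> x = \<tau> * (b + a \<bullet> y)"
    using ex_lattice_point_on_facet[OF H h, where y = y and ?p0.0 = p0 and z = z] \<open>\<beta> \<noteq> 0\<close> p0
    unfolding \<beta>_def by blast
  have x_lat: "x \<in> integer_lattice" using x by (simp add: dilate_lattice_points_def)
  \<comment> \<open>Both inequalities are strict at \<open>p0\<close>, so the factor relating them
    is positive and the slopes share a sign.\<close>
  have tightP: "\<beta> * (b' + a' \<bullet> y) > 0"
    if x': "x' \<in> dilate_lattice_points H y \<tau>" and ab': "(a', b') \<in> H" and tight: "a' \<bullet> x' = \<tau> * (b' + a' \<bullet> y)" for x' a' b'
  proof -
    obtain c where c: "c \<noteq> 0" "a' = c *\<^sub>R a" "b' = c * b"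
      using tight_proportional[OF indep, where a = a and b = b and a' = a' and b' = b' and x = x
          and x' = x' and \<tau> = \<tau>] Hrat[OF h] Hrat[OF ab'] x(2) x_lat x' tight \<tau>
      unfolding dilate_lattice_points_def by blast
    have "c * (b - a \<bullet> p0) > 0" using p0[OF ab'] c by (simp add: algebra_simps)
    then have "c > 0" using p0[OF h] by (simp add: zero_less_mult_iff)
    moreover have "\<beta> * (b' + a' \<bullet> y) = c * (\<beta> * \<beta>)" using c by (simp add: \<beta>_def algebra_simps)
    moreover have "\<beta> * \<beta> > 0" using \<open>\<beta> \<noteq> 0\<close> by (simp add: zero_less_mult_iff) linarith
    ultimately show ?thesis by (metis mult_pos_pos)
  qed
  \<comment> \<open>Here the factor is negative: \<open>q\<close> satisfies every inequality of
    \<open>Q\<close> but violates \<open>a \<bullet> q \<le> b\<close>. A tight hyperplane of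
    \<open>Q\<close> thus bounds from the opposite side.\<close>
  have tightQ: "- \<beta> * (b' + a' \<bullet> y) > 0"
    if x': "x' \<in> dilate_lattice_points K y \<tau>" and ab': "(a', b') \<in> K" and tight: "a' \<bullet> x' = \<tau> * (b' + a' \<bullet> y)" for x' a' b'
  proof -
    obtain c where c: "c \<noteq> 0" "a' = c *\<^sub>R a" "b' = c * b"
      using tight_proportional[OF indep, where a = a and b = b and a' = a' and b' = b' and x = x
          and x' = x' and \<tau> = \<tau>] Hrat[OF h] Krat[OF ab'] x(2) x_lat x' tight \<tau>
      unfolding dilate_lattice_points_def by blast
    have "a' \<bullet> q \<le> b'" using q ab' by (auto simp: QK)
    then have "c * (a \<bullet> q - b) \<le> 0" using c by (simp add: algebra_simps)
    then have "c < 0" using c aq by (auto simp: mult_le_0_iff)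
    moreover have "- \<beta> * (b' + a' \<bullet> y) = - c * (\<beta> * \<beta>)" using c by (simp add: \<beta>_def algebra_simps)
    moreover have "\<beta> * \<beta> > 0" using \<open>\<beta> \<noteq> 0\<close> by (simp add: zero_less_mult_iff) linarith
    ultimately show ?thesis by (metis mult_pos_pos neg_0_less_iff_less)
  qed
  have bddP: "bounded {x. \<forall>(a, b)\<in>H. a \<bullet> x \<le> b}" and bddQ: "bounded {x. \<forall>(a, b)\<in>K. a \<bullet> x \<le> b}"
    using \<open>bounded P\<close> \<open>bounded Q\<close> by (simp_all add: PH QK)
  let ?A = "dilate_lattice_points H y" and ?B = "dilate_lattice_points K y"
  have "\<forall>\<^sub>F t in nhds \<tau>. t > 0 \<and> ?A t \<subseteq> ?A \<tau> \<and> ?B t \<subseteq> ?B \<tau> \<and>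
      (\<beta> * (t - \<tau>) > 0 \<longrightarrow> ?A \<tau> \<subseteq> ?A t) \<and> (- \<beta> * (t - \<tau>) > 0 \<longrightarrow> ?B \<tau> \<subseteq> ?B t)"
    by (intro eventually_conj eventually_dilate_lattice_points_subset
          eventually_dilate_lattice_points_superset H K bddP bddQ tightP tightQ \<tau>)
       (use \<tau> order_tendstoD(1)[OF filterlim_ident] in auto)
  then obtain e where "e > 0" and e: "\<And>t. \<bar>t - \<tau>\<bar> < e \<Longrightarrow> t > 0 \<and> ?A t \<subseteq> ?A \<tau> \<and> ?B t \<subseteq> ?B \<tau> \<and>
      (\<beta> * (t - \<tau>) > 0 \<longrightarrow> ?A \<tau> \<subseteq> ?A t) \<and> (- \<beta> * (t - \<tau>) > 0 \<longrightarrow> ?B \<tau> \<subseteq> ?B t)"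
    unfolding eventually_nhds_metric dist_real_def by blast
  obtain u v where u: "u \<in> \<rat>" "\<tau> - e < u" "u < \<tau>" and v: "v \<in> \<rat>" "\<tau> < v" "v < \<tau> + e"
    using Rats_dense_in_real[of "\<tau> - e" \<tau>] Rats_dense_in_real[of \<tau> "\<tau> + e"] \<open>e > 0\<close> by auto
  \<comment> \<open>On the side of \<open>s\<close> the points of \<open>Q\<close> present at \<tau>
    persist; on the side of \<open>t\<close> those of \<open>P\<close> do. The sign of \<beta>
    decides which side is earlier.\<close>
  obtain s t where s: "s \<in> \<rat>" "\<bar>s - \<tau>\<bar> < e" "\<beta> * (s - \<tau>) < 0"
    and t: "t \<in> \<rat>" "\<bar>t - \<tau>\<bar> < e" "\<beta> * (t - \<tau>) > 0"
  proof (cases "\<beta> > 0")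
    case True
    then show ?thesis using u v by (intro that[of u v]) (auto simp: mult_less_0_iff)
  next
    case False
    then show ?thesis using u v \<open>\<beta> \<noteq> 0\<close> by (intro that[of v u]) (auto simp: mult_less_0_iff zero_less_mult_iff)
  qed
  have fin: "finite (?A \<tau>)" "finite (?B \<tau>)"
    using finite_dilate_lattice_points_at[OF _ \<tau>] bddP bddQ by blast+
  have "x \<notin> ?A s"
  proof
    assume "x \<in> ?A s"
    then have "\<tau> * \<beta> \<le> s * \<beta>" using x h by (auto simp: dilate_lattice_points_def \<beta>_def)
    then show False using s by (simp add: algebra_simps)
  qed
  \<comment> \<open>From \<open>s\<close> to \<open>t\<close> the count of \<open>P\<close> strictly
    grows, as \<open>x\<close> is missing at \<open>s\<close>, while that of \<open>Q\<close> cannot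
    grow, being maximal at \<open>s\<close>.\<close>
  then have "?A s \<subset> ?A \<tau>" "?A t = ?A \<tau>" using e[OF s(2)] e[OF t(2)] t x by auto
  then have "card (?A s) < card (?A t)" using fin by (simp add: psubset_card_mono)
  moreover have "card (?B t) \<le> card (?B s)"
  proof -
    have "?B t \<subseteq> ?B \<tau>" "?B s = ?B \<tau>" using e[OF s(2)] e[OF t(2)] s by auto
    then show ?thesis using fin by (simp add: card_mono)
  qed
  moreover have "card (?A s) = card (?B s)" "card (?A t) = card (?B t)"
    using counts[OF s(1)] counts[OF t(1)] e[OF s(2)] e[OF t(2)]
    by (simp_all add: PH QK lattice_point_count_halfspaces)
  ultimately show False by simp
qed

theorem corollary1:
  fixes idx :: "'n::finite \<Rightarrow> nat"
  assumes "bij_betw idx UNIV {1..CARD('n)}"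
  shows "(y_star idx :: real ^ 'n) \<in> U_rational"
proof -
  have indep: "r = 0 \<and> s = 0" if "r \<in> rational_points" "s \<in> \<rat>" "s + r \<bullet> y_star idx = 0" for r :: "real ^ 'n" and s
    using y_star_independent[OF assms that] by simp
  show ?thesis
    unfolding U_rational_def
  proof (intro CollectI ballI impI equalityI)
    fix P Q :: "(real ^ 'n) set"
    assume PQ: "P \<in> full_dim_rational_polytopes" "Q \<in> full_dim_rational_polytopes"
      and counts: "\<forall>t\<in>\<rat>. t > 0 \<longrightarrow> lattice_point_count (translate P (y_star idx)) t =
        lattice_point_count (translate Q (y_star idx)) t"
    show "Q \<subseteq> P" by (rule equal_counts_imp_subset[OF indep PQ]) (use counts in auto)
    show "P \<subseteq> Q" by (rule equal_counts_imp_subset[OF indep PQ(2,1)]) (use counts in auto)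
  qed
qed

end
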